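(* Let $\lambda>0$, $0<\varphi<\pi$ and $n,m\in\mathbb{N}$. Then for all $x$, $$\begin{aligned}\binom{n+m}{n}P^{(\lambda)}_{m+n}(x;\varphi)=\sum_{k=0}^{\min(n,m)}&\frac{(-i)^ke^{-ik\varphi}}{k!}(2\sin\varphi)^k(\lambda+ix)_k\\&\times P^{(\lambda+\frac12k)}_{n-k}\bigl(x-\tfrac k2i;\varphi\bigr)\,P^{(\lambda+\frac12(n+k))}_{m-k}\bigl(x+\tfrac i2(n-k);\varphi\bigr).\end{aligned}$$
   Context: $\mathbb N=\{0,1,2,\dots\}$, $i=\sqrt{-1}$, $(y)_k=y(y+1)\cdots(y+k-1)$. The Meixner–Pollaczek polynomials are $$P_n^{(\lambda)}(x;\varphi)=\frac{(2\lambda)_n}{n!}e^{in\varphi}\sum_{j=0}^n\frac{(-n)_j(\lambda+ix)_j}{(2\lambda)_j\,j!}\bigl(1-e^{-2i\varphi}\bigr)^j,$$ polynomials in $x$, which may be evaluated at complex arguments. *)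

theory Defs
  imports Complex_Main
begin

definition meixner_pollaczek :: "nat \<Rightarrow> real \<Rightarrow> complex \<Rightarrow> real \<Rightarrow> complex" where
  "meixner_pollaczek n l x \<phi> =
     pochhammer (2 * of_real l) n / fact n * exp (\<i> * of_nat n * of_real \<phi>) *
     (\<Sum>j=0..n. pochhammer (- of_nat n) j * pochhammer (of_real l + \<i> * x) j
                / (pochhammer (2 * of_real l) j * fact j)
                * (1 - exp (- 2 * \<i> * of_real \<phi>)) ^ j)"

end

theory Submission
  imports Defs "HOL-Computational_Algebra.Formal_Power_Series"
begin

text \<open>
  Put \<open>a = \<lambda> + i x\<close>, \<open>b = \<lambda> - i x\<close> and \<open>w = exp (-2 i \<phi>)\<close>. Up to the factor \<open>exp (i n \<phi>)\<close>, the
  polynomial \<open>P\<^sub>n\<close> is the coefficient \<open>R\<^sub>n(a, b)\<close> of \<open>t\<^sup>n\<close> in \<open>(1 - w t)\<^sup>-\<^sup>a (1 - t)\<^sup>-\<^sup>b\<close>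
  (lemma \<open>meixner_pollaczek_eq_mp_coeff\<close>). The two parameter shifts in the theorem fix \<open>b\<close> and
  send \<open>a\<close> to \<open>a + k\<close>, respectively send \<open>(a, b)\<close> to \<open>(a + k, b + n)\<close>. So the theorem becomes
  a polynomial identity for the \<open>R\<^sub>n\<close> (lemma \<open>mp_coeff_convolution\<close>), multiplied by powers of
  \<open>exp (i \<phi>)\<close>.

  That identity combines two facts. Writing \<open>R\<^sub>n(a, b) = \<Sum>\<^sub>j T\<^sub>j\<close> for the Cauchy product, the
  Vandermonde convolution of binomial coefficients gives
  \<open>(n + m choose n) R\<^sub>n\<^sub>+\<^sub>m(a, b) = \<Sum>\<^sub>j T\<^sub>j R\<^sub>m(a + j, b + n - j)\<close> (lemma \<open>mp_coeff_add\<close>); this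
  amounts to expanding the generating function at \<open>s + t\<close> in powers of \<open>s\<close> and \<open>t\<close>. Each \<open>R\<^sub>m(a + j, b + n - j)\<close> is
  then expanded in the \<open>R\<^sub>m\<^sub>-\<^sub>k(a + k, b + n)\<close>, by expanding
  \<open>(1 - t)\<^sup>j = ((1 - w t) + (w - 1) t)\<^sup>j\<close> with the binomial theorem (lemma
  \<open>mp_coeff_connection\<close>). After exchanging the sums over \<open>j\<close> and \<open>k\<close>, the inner sum over \<open>j\<close> is
  again a Cauchy product, namely \<open>R\<^sub>n\<^sub>-\<^sub>k(a + k, b)\<close> up to a factor.
\<close>

section \<open>The generating function\<close>

text \<open>The binomial series of \<open>(1 - w t)\<^sup>-\<^sup>a\<close>.\<close>

definition neg_binomial_fps :: "complex \<Rightarrow> complex \<Rightarrow> complex fps" where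
  "neg_binomial_fps w a = Abs_fps (\<lambda>n. pochhammer a n / fact n * w ^ n)"

text \<open>Using \<open>a\<close> and \<open>b\<close> in place of \<open>\<lambda>\<close> and \<open>x\<close> turns the half-integer and imaginary shifts of the
  theorem into integer shifts, which multiply a factor of the generating function
  \<open>(1 - w t)\<^sup>-\<^sup>a (1 - t)\<^sup>-\<^sup>b\<close> by a power of \<open>1 - w t\<close> or \<open>1 - t\<close>.\<close>

definition mp_coeff :: "complex \<Rightarrow> complex \<Rightarrow> complex \<Rightarrow> nat \<Rightarrow> complex" where
  "mp_coeff w a b n = fps_nth (neg_binomial_fps w a * neg_binomial_fps 1 b) n"

lemma mp_coeff_sum:
  "mp_coeff w a b n =
     (\<Sum>j\<le>n. pochhammer a j / fact j * w ^ j * (pochhammer b (n - j) / fact (n - j)))"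
  by (simp add: mp_coeff_def neg_binomial_fps_def fps_mult_nth atLeast0AtMost)

lemma neg_binomial_fps_step:
  "(1 - fps_const w * fps_X) * neg_binomial_fps w (a + 1) = neg_binomial_fps w a"
proof (rule fps_ext)
  fix n
  show "fps_nth ((1 - fps_const w * fps_X) * neg_binomial_fps w (a + 1)) n
      = fps_nth (neg_binomial_fps w a) n"
  proof (cases n)
    case 0
    then show ?thesis
      by (simp add: neg_binomial_fps_def)
  next
    case (Suc k)
    have p: "pochhammer (a + 1) (Suc k) = pochhammer (a + 1) k * (a + 1 + of_nat k)"
      by (simp add: pochhammer_Suc)
    have q: "pochhammer a (Suc k) = a * pochhammer (a + 1) k"
      by (simp add: pochhammer_rec)
    have f: "(fact (Suc k) :: complex) = (of_nat k + 1) * fact k"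
      by (simp add: algebra_simps)
    have nz: "(of_nat k + 1 :: complex) \<noteq> 0"
      by (metis of_nat_Suc of_nat_eq_0_iff nat.distinct(1) add.commute)
    have "pochhammer (a + 1) (Suc k) / fact (Suc k) * w ^ Suc k
          - w * (pochhammer (a + 1) k / fact k * w ^ k) = pochhammer a (Suc k) / fact (Suc k) * w ^ Suc k"
      unfolding p q f using nz by (simp add: divide_simps) (simp add: algebra_simps)
    then show ?thesis
      unfolding Suc neg_binomial_fps_def
      by (simp add: left_diff_distrib mult.assoc del: fact_Suc power_Suc)
  qed
qed

lemma neg_binomial_fps_shift:
  "(1 - fps_const w * fps_X) ^ j * neg_binomial_fps w (a + of_nat j) = neg_binomial_fps w a"
proof (induction j)
  case 0
  show ?case by simp
next
  case (Suc j)
  have "(1 - fps_const w * fps_X) ^ Suc j * neg_binomial_fps w (a + of_nat (Suc j))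
    = (1 - fps_const w * fps_X) ^ j *
        ((1 - fps_const w * fps_X) * neg_binomial_fps w (a + of_nat j + 1))"
    by (simp add: mult_ac add_ac)
  then show ?case
    by (simp only: neg_binomial_fps_step Suc.IH)
qed

text \<open>
  Multiplying \<open>(1 - t)\<^sup>-\<^sup>b\<^sup>-\<^sup>j\<close> by \<open>(1 - t)\<^sup>j\<close> and \<open>(1 - w t)\<^sup>-\<^sup>a\<^sup>-\<^sup>j\<close> by \<open>(1 - w t)\<^sup>j\<^sup>-\<^sup>k\<close> shifts the
  parameters, so the binomial expansion of \<open>(1 - t)\<^sup>j\<close> in powers of \<open>1 - w t\<close> and \<open>(w - 1) t\<close>
  trades a shift of \<open>a\<close> for a shift of \<open>b\<close>.
\<close>

lemma mp_coeff_connection: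
  "mp_coeff w (a + of_nat j) b m =
     (\<Sum>k\<le>j. if k \<le> m
        then of_nat (j choose k) * (w - 1) ^ k * mp_coeff w (a + of_nat k) (b + of_nat j) (m - k)
        else 0)"
proof -
  let ?v = "1 - fps_const w * fps_X" and ?y = "fps_const (w - 1) * fps_X"
  let ?A = "neg_binomial_fps w" and ?B = "neg_binomial_fps 1"
  have one_minus_X: "1 - fps_X = ?y + ?v"
    by (simp add: fps_const_sub [symmetric] algebra_simps del: fps_const_sub)
  have "?A (a + of_nat j) * ?B b = ?A (a + of_nat j) * ((?y + ?v) ^ j * ?B (b + of_nat j))"
    using neg_binomial_fps_shift [of 1 j b] by (simp add: one_minus_X)
  also have "\<dots> = (\<Sum>k\<le>j. of_nat (j choose k) * ?y ^ k *
                   (?v ^ (j - k) * ?A (a + of_nat j)) * ?B (b + of_nat j))"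
    by (simp add: binomial_ring sum_distrib_left sum_distrib_right mult_ac)
  also have "\<dots> = (\<Sum>k\<le>j. fps_X ^ k * (fps_const (of_nat (j choose k) * (w - 1) ^ k) *
                   (?A (a + of_nat k) * ?B (b + of_nat j))))"
  proof (rule sum.cong [OF refl])
    fix k assume "k \<in> {..j}"
    then have "a + of_nat j = (a + of_nat k) + of_nat (j - k)"
      by (simp add: of_nat_diff)
    then have "?v ^ (j - k) * ?A (a + of_nat j) = ?A (a + of_nat k)"
      using neg_binomial_fps_shift [of w "j - k" "a + of_nat k"] by (simp only:)
    moreover have "of_nat (j choose k) * ?y ^ k
        = fps_X ^ k * fps_const (of_nat (j choose k) * (w - 1) ^ k)"
      by (simp add: power_mult_distrib fps_const_power fps_of_nat [symmetric]
          fps_const_mult [symmetric] mult_ac del: fps_const_mult)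
    ultimately show "of_nat (j choose k) * ?y ^ k *
          (?v ^ (j - k) * ?A (a + of_nat j)) * ?B (b + of_nat j)
        = fps_X ^ k * (fps_const (of_nat (j choose k) * (w - 1) ^ k) *
                   (?A (a + of_nat k) * ?B (b + of_nat j)))"
      by (simp only: mult.assoc)
  qed
  finally show ?thesis
    unfolding mp_coeff_def
    by (auto simp: fps_sum_nth fps_X_power_mult_nth mult.assoc intro!: sum.cong)
qed

section \<open>The convolution identity\<close>

lemma binomial_sum_Suc:
  fixes h :: "nat \<Rightarrow> 'a::comm_semiring_1"
  shows "(\<Sum>J\<le>Suc N. of_nat (Suc N choose J) * h J)
       = (\<Sum>J\<le>N. of_nat (N choose J) * (h J + h (Suc J)))"
proof -
  have "(\<Sum>J\<le>N. of_nat (N choose Suc J) * h (Suc J)) + h 0 = (\<Sum>J\<le>Suc N. of_nat (N choose J) * h J)"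
    by (subst sum.atMost_Suc_shift) (simp add: add.commute)
  also have "\<dots> = (\<Sum>J\<le>N. of_nat (N choose J) * h J)"
    by (simp add: binomial_eq_0)
  finally have shifted: "(\<Sum>J\<le>N. of_nat (N choose Suc J) * h (Suc J)) + h 0 =
      (\<Sum>J\<le>N. of_nat (N choose J) * h J)" .
  have "(\<Sum>J\<le>Suc N. of_nat (Suc N choose J) * h J)
      = ((\<Sum>J\<le>N. of_nat (N choose Suc J) * h (Suc J)) + h 0) +
        (\<Sum>J\<le>N. of_nat (N choose J) * h (Suc J))"
    by (subst sum.atMost_Suc_shift) (simp add: distrib_right sum.distrib add_ac)
  then show ?thesis
    unfolding shifted by (simp add: distrib_left sum.distrib)
qed

text \<open>
  Vandermonde's convolution in dual form. If \<open>E\<close> is the shift operator on sequences, both sides are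
  the value at \<open>0\<close> of \<open>(1 + E)\<^sup>n\<^sup>+\<^sup>m h\<close>. Keeping \<open>h\<close> arbitrary avoids a sum over the pairs
  \<open>(j, i)\<close> with \<open>j + i = J\<close>.
\<close>

lemma binomial_sum_add:
  fixes h :: "nat \<Rightarrow> 'a::comm_semiring_1"
  shows "(\<Sum>J\<le>n + m. of_nat (n + m choose J) * h J)
       = (\<Sum>j\<le>n. of_nat (n choose j) * (\<Sum>i\<le>m. of_nat (m choose i) * h (j + i)))"
proof (induction n arbitrary: h)
  case 0
  show ?case by simp
next
  case (Suc n)
  have "(\<Sum>J\<le>Suc n + m. of_nat (Suc n + m choose J) * h J)
      = (\<Sum>J\<le>n + m. of_nat (n + m choose J) * (h J + h (Suc J)))"
    unfolding add_Suc by (rule binomial_sum_Suc)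
  also have "\<dots> = (\<Sum>j\<le>n. of_nat (n choose j) *
      ((\<Sum>i\<le>m. of_nat (m choose i) * h (j + i)) + (\<Sum>i\<le>m. of_nat (m choose i) * h (Suc j + i))))"
    unfolding Suc.IH by (simp add: distrib_left sum.distrib)
  also have "\<dots> = (\<Sum>j\<le>Suc n. of_nat (Suc n choose j) * (\<Sum>i\<le>m. of_nat (m choose i) * h (j + i)))"
    by (rule binomial_sum_Suc [symmetric])
  finally show ?case .
qed

lemma sum_atMost_swap:
  fixes f :: "nat \<Rightarrow> nat \<Rightarrow> 'a::comm_monoid_add"
  shows "(\<Sum>j\<le>n. \<Sum>k\<le>j. f j k) = (\<Sum>k\<le>n. \<Sum>i\<le>n - k. f (k + i) k)"
proof -
  have "(\<Sum>j\<le>n. \<Sum>k\<le>j. f j k) = (\<Sum>j\<le>n. \<Sum>k\<le>j. f (k + (j - k)) k)"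
    by simp
  also have "\<dots> = (\<Sum>(k, i)\<in>{(k, i). k + i \<le> n}. f (k + i) k)"
    by (rule sum.triangle_reindex_eq [symmetric])
  also have "{(k, i). k + i \<le> n} = (SIGMA k:{..n}. {..n - k})"
    by auto
  finally show ?thesis
    by (simp add: sum.Sigma)
qed

text \<open>
  \<open>n! m! (n + m choose n) R\<^sub>n\<^sub>+\<^sub>m\<close> is a binomial sum of length \<open>n + m\<close>, hence by
  \<open>binomial_sum_add\<close> an iterated binomial sum of lengths \<open>n\<close> and \<open>m\<close>; factoring the Pochhammer
  symbols at \<open>j\<close> and \<open>n - j\<close> makes its inner sum an \<open>R\<^sub>m\<close> with shifted parameters.
\<close>

lemma mp_coeff_add:
  "of_nat ((n + m) choose n) * mp_coeff w a b (n + m) =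
     (\<Sum>j\<le>n. pochhammer a j / fact j * w ^ j * (pochhammer b (n - j) / fact (n - j)) *
        mp_coeff w (a + of_nat j) (b + of_nat (n - j)) m)"
proof -
  define h where "h = (\<lambda>J. pochhammer a J * w ^ J * pochhammer b (n + m - J))"
  have "of_nat ((n + m) choose n) * mp_coeff w a b (n + m)
      = (\<Sum>J\<le>n + m. of_nat ((n + m) choose J) * h J) / (fact n * fact m)"
    unfolding mp_coeff_sum sum_distrib_left sum_divide_distrib
    by (intro sum.cong refl) (simp add: h_def binomial_fact field_simps)
  also have "\<dots> = (\<Sum>j\<le>n. \<Sum>i\<le>m. of_nat (n choose j) * (of_nat (m choose i) * h (j + i)))
        / (fact n * fact m)"
    by (simp add: binomial_sum_add sum_distrib_left)
  also have "\<dots> = (\<Sum>j\<le>n. pochhammer a j / fact j * w ^ j * (pochhammer b (n - j) / fact (n - j)) *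
        mp_coeff w (a + of_nat j) (b + of_nat (n - j)) m)"
    unfolding mp_coeff_sum sum_distrib_left sum_divide_distrib
  proof (intro sum.cong refl)
    fix j i assume "j \<in> {..n}" "i \<in> {..m}"
    then have ji: "j \<le> n" "i \<le> m" and e: "n + m - (j + i) = (n - j) + (m - i)"
      by auto
    show "of_nat (n choose j) * (of_nat (m choose i) * h (j + i)) / (fact n * fact m)
       = pochhammer a j / fact j * w ^ j * (pochhammer b (n - j) / fact (n - j)) *
         (pochhammer (a + of_nat j) i / fact i * w ^ i *
          (pochhammer (b + of_nat (n - j)) (m - i) / fact (m - i)))"
      unfolding h_def e pochhammer_product' binomial_fact [OF ji(1)] binomial_fact [OF ji(2)]
        power_add
      by (simp add: field_simps)
  qed
  finally show ?thesis .
qed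

text \<open>
  In \<open>mp_coeff_add\<close> the shifts of the two parameters add up to \<open>n\<close>, so \<open>mp_coeff_connection\<close>
  brings the second parameter of every \<open>R\<^sub>m\<close> to the common value \<open>b + n\<close>.
\<close>

lemma mp_coeff_convolution:
  "of_nat ((n + m) choose n) * mp_coeff w a b (n + m) =
     (\<Sum>k\<le>min n m. ((w - 1) * w) ^ k * pochhammer a k / fact k *
        mp_coeff w (a + of_nat k) b (n - k) *
        mp_coeff w (a + of_nat k) (b + of_nat n) (m - k))"
proof -
  let ?M = "\<lambda>k. mp_coeff w (a + of_nat k) (b + of_nat n) (m - k)"
  have "of_nat ((n + m) choose n) * mp_coeff w a b (n + m) =
     (\<Sum>j\<le>n. \<Sum>k\<le>j. if k \<le> m then
        pochhammer a j / fact j * w ^ j * (pochhammer b (n - j) / fact (n - j)) *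
        (of_nat (j choose k) * (w - 1) ^ k * ?M k) else 0)"
    unfolding mp_coeff_add
  proof (intro sum.cong refl)
    fix j assume "j \<in> {..n}"
    then have b: "b + of_nat (n - j) + of_nat j = b + of_nat n"
      by (simp add: of_nat_diff)
    show "pochhammer a j / fact j * w ^ j * (pochhammer b (n - j) / fact (n - j)) *
        mp_coeff w (a + of_nat j) (b + of_nat (n - j)) m
      = (\<Sum>k\<le>j. if k \<le> m then
        pochhammer a j / fact j * w ^ j * (pochhammer b (n - j) / fact (n - j)) *
        (of_nat (j choose k) * (w - 1) ^ k * ?M k) else 0)"
      unfolding mp_coeff_connection [of w a j "b + of_nat (n - j)" m] b sum_distrib_left
      by (intro sum.cong refl) (simp only: mult_zero_right split: if_split, simp)
  qed
  also have "\<dots> = (\<Sum>k\<le>n. \<Sum>i\<le>n - k. if k \<le> m then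
        pochhammer a (k + i) / fact (k + i) * w ^ (k + i) *
        (pochhammer b (n - (k + i)) / fact (n - (k + i))) *
        (of_nat ((k + i) choose k) * (w - 1) ^ k * ?M k) else 0)"
    by (rule sum_atMost_swap)
  also have "\<dots> = (\<Sum>k\<le>n. if k \<le> m then ((w - 1) * w) ^ k * pochhammer a k / fact k *
        mp_coeff w (a + of_nat k) b (n - k) * ?M k else 0)"
  proof (intro sum.cong refl)
    fix k
    have "pochhammer a (k + i) / fact (k + i) * w ^ (k + i) *
        (pochhammer b (n - (k + i)) / fact (n - (k + i))) *
        (of_nat ((k + i) choose k) * (w - 1) ^ k * ?M k)
      = ((w - 1) * w) ^ k * pochhammer a k / fact k *
        (pochhammer (a + of_nat k) i / fact i * w ^ i *
         (pochhammer b (n - k - i) / fact (n - k - i))) * ?M k" for i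
      unfolding pochhammer_product' power_add power_mult_distrib
      by (simp add: binomial_fact field_simps)
    then show "(\<Sum>i\<le>n - k. if k \<le> m then
        pochhammer a (k + i) / fact (k + i) * w ^ (k + i) *
        (pochhammer b (n - (k + i)) / fact (n - (k + i))) *
        (of_nat ((k + i) choose k) * (w - 1) ^ k * ?M k) else 0)
      = (if k \<le> m then ((w - 1) * w) ^ k * pochhammer a k / fact k *
        mp_coeff w (a + of_nat k) b (n - k) * ?M k else 0)"
      by (simp add: mp_coeff_sum [of w _ b] sum_distrib_left sum_distrib_right)
  qed
  also have "\<dots> = (\<Sum>k\<le>min n m. ((w - 1) * w) ^ k * pochhammer a k / fact k *
        mp_coeff w (a + of_nat k) b (n - k) * ?M k)"
    by (rule sum.mono_neutral_cong_right) auto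
  finally show ?thesis .
qed

section \<open>Meixner--Pollaczek polynomials as coefficients\<close>

lemma pochhammer_vandermonde:
  fixes a b :: complex
  shows "(\<Sum>i\<le>n. pochhammer a i / fact i * (pochhammer b (n - i) / fact (n - i)))
       = pochhammer (a + b) n / fact n"
  unfolding pochhammer_binomial_sum sum_divide_distrib
  by (intro sum.cong refl) (simp add: binomial_fact field_simps)

text \<open>
  Expanding the powers of \<open>1 - z\<close> in the Cauchy product turns the coefficient of each \<open>(-z)\<^sup>k\<close> into
  a Chu--Vandermonde sum, which depends on \<open>b\<close> only through \<open>a + b\<close>: the terminating
  \<open>\<^sub>2F\<^sub>1(-n, a; a + b; z)\<close>.
\<close>

lemma mp_coeff_hypergeometric:
  "mp_coeff (1 - z) a b n =
     (\<Sum>k\<le>n. (- z) ^ k * pochhammer a k / fact k *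
        (pochhammer (a + b + of_nat k) (n - k) / fact (n - k)))"
proof -
  have "mp_coeff (1 - z) a b n = (\<Sum>j\<le>n. \<Sum>k\<le>j. pochhammer a j / fact j *
      (of_nat (j choose k) * (- z) ^ k) * (pochhammer b (n - j) / fact (n - j)))"
    unfolding mp_coeff_sum
  proof (intro sum.cong refl)
    fix j
    have "(1 - z) ^ j = (\<Sum>k\<le>j. of_nat (j choose k) * (- z) ^ k)"
      using binomial_ring [of "- z" 1 j] by (simp add: add.commute)
    then show "pochhammer a j / fact j * (1 - z) ^ j * (pochhammer b (n - j) / fact (n - j))
       = (\<Sum>k\<le>j. pochhammer a j / fact j *
      (of_nat (j choose k) * (- z) ^ k) * (pochhammer b (n - j) / fact (n - j)))"
      by (simp only: sum_distrib_left sum_distrib_right)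
  qed
  also have "\<dots> = (\<Sum>k\<le>n. \<Sum>i\<le>n - k. pochhammer a (k + i) / fact (k + i) *
      (of_nat ((k + i) choose k) * (- z) ^ k) *
      (pochhammer b (n - (k + i)) / fact (n - (k + i))))"
    by (rule sum_atMost_swap)
  also have "\<dots> = (\<Sum>k\<le>n. (- z) ^ k * pochhammer a k / fact k *
      (\<Sum>i\<le>n - k. pochhammer (a + of_nat k) i / fact i *
         (pochhammer b (n - k - i) / fact (n - k - i))))"
    unfolding sum_distrib_left pochhammer_product'
    by (intro sum.cong refl) (simp add: binomial_fact field_simps)
  finally show ?thesis
    unfolding pochhammer_vandermonde by (simp add: add_ac)
qed

text \<open>
  Since \<open>a + b = 2 \<lambda>\<close>, the hypergeometric form of \<open>R\<^sub>n(a, b)\<close> is the defining sum once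
  \<open>(2\<lambda>)\<^sub>n / (2\<lambda>)\<^sub>j\<close> is written as \<open>(2\<lambda> + j)\<^sub>n\<^sub>-\<^sub>j\<close>. Positivity of \<open>\<lambda>\<close> keeps the denominators
  \<open>(2\<lambda>)\<^sub>j\<close> away from zero.
\<close>

lemma meixner_pollaczek_eq_mp_coeff:
  assumes "l > 0"
  shows "meixner_pollaczek n l x \<phi> = exp (\<i> * of_real \<phi>) ^ n *
     mp_coeff (exp (- 2 * \<i> * of_real \<phi>)) (of_real l + \<i> * x) (of_real l - \<i> * x) n"
proof -
  let ?z = "1 - exp (- 2 * \<i> * of_real \<phi>)"
  let ?a = "of_real l + \<i> * x" and ?c = "2 * of_real l :: complex"
  have nz: "pochhammer ?c j \<noteq> 0" for j
  proof -
    have "pochhammer (2 * l) j > 0"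
      using assms by (intro pochhammer_pos) simp
    moreover have "pochhammer ?c j = of_real (pochhammer (2 * l) j)"
      by (simp add: pochhammer_of_real [symmetric])
    ultimately show ?thesis by simp
  qed
  have "pochhammer ?c n / fact n * (\<Sum>j=0..n. pochhammer (- of_nat n) j * pochhammer ?a j
          / (pochhammer ?c j * fact j) * ?z ^ j)
      = (\<Sum>j\<le>n. (- ?z) ^ j * pochhammer ?a j / fact j *
          (pochhammer (?c + of_nat j) (n - j) / fact (n - j)))"
    unfolding sum_distrib_left atLeast0AtMost
  proof (intro sum.cong refl)
    fix j assume "j \<in> {..n}"
    then have j: "j \<le> n" by simp
    have "(of_nat (n choose j) :: complex) = (- 1) ^ j * pochhammer (- of_nat n) j / fact j"
      by (simp add: binomial_gbinomial gbinomial_pochhammer)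
    then have "pochhammer (- of_nat n :: complex) j = (- 1) ^ j * (fact j * of_nat (n choose j))"
      by (simp add: power_mult_distrib [symmetric])
    also have "\<dots> = (- 1) ^ j * (fact n / fact (n - j))"
      using j by (simp add: binomial_fact)
    finally have p: "pochhammer (- of_nat n :: complex) j = (- 1) ^ j * (fact n / fact (n - j))" .
    show "pochhammer ?c n / fact n * (pochhammer (- of_nat n) j * pochhammer ?a j
          / (pochhammer ?c j * fact j) * ?z ^ j)
      = (- ?z) ^ j * pochhammer ?a j / fact j *
          (pochhammer (?c + of_nat j) (n - j) / fact (n - j))"
      unfolding p pochhammer_product [OF j, of ?c] power_minus [of ?z]
      using nz [of j] by (simp add: field_simps)
  qed
  also have "\<dots> = mp_coeff (1 - ?z) ?a (of_real l - \<i> * x) n"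
    unfolding mp_coeff_hypergeometric by simp
  finally have "meixner_pollaczek n l x \<phi> = exp (\<i> * of_nat n * of_real \<phi>) *
     mp_coeff (1 - ?z) ?a (of_real l - \<i> * x) n"
    unfolding meixner_pollaczek_def
    by (subst mult.commute [of "pochhammer ?c n / fact n"]) (simp only: mult.assoc)
  moreover have "exp (\<i> * of_nat n * of_real \<phi>) = exp (\<i> * of_real \<phi>) ^ n"
    by (simp add: exp_of_nat_mult [symmetric] mult_ac)
  ultimately show ?thesis
    by simp
qed

section \<open>The convolution formula for Meixner--Pollaczek polynomials\<close>

theorem mainTheorem6:
  fixes l \<phi> :: real and n m :: nat and x :: complex
  assumes "l > 0" and "0 < \<phi>" and "\<phi> < pi"
  shows "of_nat ((n + m) choose n) * meixner_pollaczek (m + n) l x \<phi> =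
    (\<Sum>k=0..min n m.
        (- \<i>) ^ k * exp (- \<i> * of_nat k * of_real \<phi>) / fact k
        * (2 * of_real (sin \<phi>)) ^ k * pochhammer (of_real l + \<i> * x) k
        * meixner_pollaczek (n - k) (l + 1 / 2 * real k) (x - of_nat k / 2 * \<i>) \<phi>
        * meixner_pollaczek (m - k) (l + 1 / 2 * real (n + k))
            (x + \<i> / 2 * of_nat (n - k)) \<phi>)"
proof -
  define e where "e = exp (\<i> * of_real \<phi>)"
  define w where "w = exp (- 2 * \<i> * of_real \<phi>)"
  let ?a = "of_real l + \<i> * x" and ?b = "of_real l - \<i> * x"
  have e0: "e \<noteq> 0"
    by (simp add: e_def)
  have w: "w = inverse e * inverse e"
    by (simp add: w_def e_def exp_minus [symmetric] exp_add [symmetric] mult.assoc)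
  have s: "- \<i> * (2 * of_real (sin \<phi>)) = inverse e - e"
    by (rule complex_eqI) (simp_all add: e_def cis_conv_exp [symmetric] cis_inverse)
  have "of_nat ((n + m) choose n) * meixner_pollaczek (m + n) l x \<phi>
      = e ^ (n + m) * (of_nat ((n + m) choose n) * mp_coeff w ?a ?b (n + m))"
    unfolding meixner_pollaczek_eq_mp_coeff [OF assms(1)] e_def w_def
    by (simp only: add.commute [of m n] mult_ac)
  also have "\<dots> = (\<Sum>k=0..min n m. e ^ (n + m) * (((w - 1) * w) ^ k * pochhammer ?a k / fact k *
        mp_coeff w (?a + of_nat k) ?b (n - k) *
        mp_coeff w (?a + of_nat k) (?b + of_nat n) (m - k)))"
    by (simp add: mp_coeff_convolution sum_distrib_left atLeast0AtMost)
  also have "\<dots> = (\<Sum>k=0..min n m.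
        (- \<i>) ^ k * exp (- \<i> * of_nat k * of_real \<phi>) / fact k
        * (2 * of_real (sin \<phi>)) ^ k * pochhammer ?a k
        * meixner_pollaczek (n - k) (l + 1 / 2 * real k) (x - of_nat k / 2 * \<i>) \<phi>
        * meixner_pollaczek (m - k) (l + 1 / 2 * real (n + k))
            (x + \<i> / 2 * of_nat (n - k)) \<phi>)"
  proof (intro sum.cong refl)
    fix k assume "k \<in> {0..min n m}"
    then have k: "k \<le> n" "k \<le> m" by auto
    have P: "meixner_pollaczek (n - k) (l + 1 / 2 * real k) (x - of_nat k / 2 * \<i>) \<phi>
        = e ^ (n - k) * mp_coeff w (?a + of_nat k) ?b (n - k)"
      using assms(1)
      by (subst meixner_pollaczek_eq_mp_coeff) (simp_all add: e_def w_def algebra_simps add_pos_nonneg)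
    have Q: "meixner_pollaczek (m - k) (l + 1 / 2 * real (n + k)) (x + \<i> / 2 * of_nat (n - k)) \<phi>
        = e ^ (m - k) * mp_coeff w (?a + of_nat k) (?b + of_nat n) (m - k)"
    proof -
      have "of_real (l + 1 / 2 * real (n + k)) + \<i> * (x + \<i> / 2 * of_nat (n - k)) = ?a + of_nat k"
        "of_real (l + 1 / 2 * real (n + k)) - \<i> * (x + \<i> / 2 * of_nat (n - k)) = ?b + of_nat n"
        using k by (simp_all add: of_nat_diff field_simps)
      moreover have "l + 1 / 2 * real (n + k) > 0"
        using assms(1) by (simp add: add_pos_nonneg)
      ultimately show ?thesis
        by (simp only: meixner_pollaczek_eq_mp_coeff e_def w_def)
    qed
    have x: "exp (- \<i> * of_nat k * of_real \<phi>) = inverse e ^ k"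
      by (simp add: e_def exp_minus [symmetric] exp_of_nat_mult [symmetric] mult_ac)
    \<comment> \<open>Each of \<open>n - k\<close> and \<open>m - k\<close> loses a power \<open>e\<^sup>k\<close>; together these supply the factor \<open>w\<^sup>k\<close>, while
        \<open>-i (2 sin \<phi>)\<close> over \<open>e\<close> is \<open>w - 1\<close>.\<close>
    have c: "(- \<i>) ^ k * inverse e ^ k * (2 * of_real (sin \<phi>)) ^ k * e ^ (n - k) * e ^ (m - k)
        = e ^ (n + m) * ((w - 1) * w) ^ k"
    proof -
      have "(- \<i>) ^ k * inverse e ^ k * (2 * of_real (sin \<phi>)) ^ k = ((inverse e - e) * inverse e) ^ k"
        unfolding s [symmetric] by (simp only: power_mult_distrib mult_ac)
      also have "(inverse e - e) * inverse e = w - 1"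
        using e0 by (simp add: w left_diff_distrib)
      finally have "(- \<i>) ^ k * inverse e ^ k * (2 * of_real (sin \<phi>)) ^ k = (w - 1) ^ k" .
      moreover have "e ^ (n + m) * w ^ k = e ^ (n - k) * e ^ (m - k)"
      proof -
        have "e ^ n = e ^ (n - k) * e ^ k" "e ^ m = e ^ (m - k) * e ^ k"
          using k by (simp_all flip: power_add)
        then have "e ^ (n + m) * w ^ k
            = e ^ (n - k) * e ^ (m - k) * ((e * inverse e) ^ k * (e * inverse e) ^ k)"
          unfolding w power_add by (simp only: power_mult_distrib mult_ac)
        then show ?thesis
          using e0 by simp
      qed
      ultimately have "(- \<i>) ^ k * inverse e ^ k * (2 * of_real (sin \<phi>)) ^ k * (e ^ (n - k) * e ^ (m - k))
          = (w - 1) ^ k * (e ^ (n + m) * w ^ k)"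
        by (simp only:)
      then show ?thesis
        by (simp only: power_mult_distrib mult_ac)
    qed
    show "e ^ (n + m) * (((w - 1) * w) ^ k * pochhammer ?a k / fact k *
        mp_coeff w (?a + of_nat k) ?b (n - k) *
        mp_coeff w (?a + of_nat k) (?b + of_nat n) (m - k))
      = (- \<i>) ^ k * exp (- \<i> * of_nat k * of_real \<phi>) / fact k
        * (2 * of_real (sin \<phi>)) ^ k * pochhammer ?a k
        * meixner_pollaczek (n - k) (l + 1 / 2 * real k) (x - of_nat k / 2 * \<i>) \<phi>
        * meixner_pollaczek (m - k) (l + 1 / 2 * real (n + k))
            (x + \<i> / 2 * of_nat (n - k)) \<phi>"
      unfolding P Q x using arg_cong [OF c, of "\<lambda>t. t * (pochhammer ?a k / fact k *
        mp_coeff w (?a + of_nat k) ?b (n - k) *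
        mp_coeff w (?a + of_nat k) (?b + of_nat n) (m - k))"]
      by (simp only: mult_ac times_divide_eq_left times_divide_eq_right)
  qed
  finally show ?thesis .
qed

end
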